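(* Consider the SDE $d\tilde Y_t=f(\tilde Y_t)\,dt+g(\tilde Y_t)\,dW_t$ of the context. If $f$ and $g$ satisfy Assumption E1 and $h^\delta$ satisfies Assumption E2 (both stated in the context), then the discrete-time adaptive approximate solution $\{\tilde X_{t_n}\}_{n\ge0}$ is almost surely exponentially stable, i.e. there exists $\lambda>0$ such that $$\limsup_{n\to\infty}\frac{\log|\tilde X_{t_n}|}{t_n}\le-\lambda\quad\text{a.s.}$$
   Context: Setting. Let $(\Omega,\mathcal F,\mathbb P)$ be a complete probability space with a filtration $\{\mathcal F_t\}_{t\ge0}$ satisfying the usual conditions, and let $W$ be a standard $d$-dimensional Brownian motion on it. $|\cdot|$ is the Euclidean norm, $\langle\cdot,\cdot\rangle$ the inner product, $\|A\|=\sqrt{\mathrm{trace}(A^TA)}$ for matrices. Consider the $m$-dimensional SDE $$d\tilde Y_t=f(\tilde Y_t)\,dt+g(\tilde Y_t)\,dW_t,\quad t\ge0,$$ with $f:\mathbb R^m\to\mathbb R^m$, $g:\mathbb R^m\to\mathbb R^{m\times d}$ Borel measurable and initial value $\tilde Y_0=\xi$, an $\mathcal F_0$-measurable $\mathbb R^m$-valued random variable with $\mathbb E|\xi|^2<\infty$. Adaptive scheme. For $\delta\in(0,1)$ let $h^\delta:\mathbb R^m\to\mathbb R^+$ (strictly positive). Set $t_0=0$, $\tilde X_0=\tilde Y_0$, and for $n\ge0$: $h^\delta_n=h^\delta(\tilde X_{t_n})$, $t_{n+1}=t_n+h^\delta_n$, $$\tilde X_{t_{n+1}}=\tilde X_{t_n}+f(\tilde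 X_{t_n})h^\delta_n+g(\tilde X_{t_n})(W_{t_{n+1}}-W_{t_n}).$$ Convention: $\log0=-\infty$. Assumption E1. For every $R>0$ there is $C_R>0$ such that $|f(x)-f(y)|+\|g(x)-g(y)\|\le C_R|x-y|$ for all $x,y\in\mathbb R^m$ with $|x|,|y|\le R$; and there exists a constant $\alpha>0$ such that for all $x\in\mathbb R^m$: $\langle x,f(x)\rangle+\tfrac12\|g(x)\|^2\le-\alpha|x|^2$. Assumption E2. The function $h^\delta$ is continuous, and there is a constant $\alpha>0$ such that for all $x\in\mathbb R^m$: $\langle x,f(x)\rangle+\tfrac d2\|g(x)\|^2+\tfrac12h^\delta(x)|f(x)|^2\le-\alpha|x|^2$. Furthermore, $h^\delta$ is uniformly bounded by a real number $h^\delta_{\max}\in(0,\infty)$. *)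

theory Defs
  imports "HOL-Probability.Probability"
begin

definition frobenius_norm :: "real^'d^'m \<Rightarrow> real" where
  "frobenius_norm A = sqrt (trace (transpose A ** A))"

text \<open>Time is \<open>real\<close>, restricted to \<open>t \<ge> 0\<close>: the values of \<open>F\<close> (and of \<open>W\<close> below)
  at negative times are irrelevant.\<close>

definition usual_filtration :: "'w measure \<Rightarrow> (real \<Rightarrow> 'w measure) \<Rightarrow> bool" where
  "usual_filtration M F \<longleftrightarrow>
     (\<forall>t\<ge>0. subalgebra M (F t)) \<and>
     (\<forall>s\<ge>0. \<forall>t\<ge>s. sets (F s) \<subseteq> sets (F t)) \<and>
     (\<forall>t\<ge>0. sets (F t) = (\<Inter>s\<in>{t<..}. sets (F s))) \<and>
     null_sets M \<subseteq> sets (F 0)"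

text \<open>Standard Brownian motion relative to the filtration \<open>F\<close>. The product of the
  one-dimensional densities is the density of the \<open>d\<close>-dimensional normal law with mean \<open>0\<close> and
  covariance \<open>(t - s) I\<close>.\<close>

definition standard_brownian_motion ::
  "'w measure \<Rightarrow> (real \<Rightarrow> 'w measure) \<Rightarrow> (real \<Rightarrow> 'w \<Rightarrow> real^'d) \<Rightarrow> bool" where
  "standard_brownian_motion M F W \<longleftrightarrow>
     (\<forall>t\<ge>0. W t \<in> borel_measurable (F t)) \<and>
     (AE \<omega> in M. W 0 \<omega> = 0) \<and>
     (AE \<omega> in M. continuous_on {0..} (\<lambda>t. W t \<omega>)) \<and>
     (\<forall>s t. 0 \<le> s \<and> s < t \<longrightarrow>
        prob_space.indep_set M (sets (F s))
          {(\<lambda>\<omega>. W t \<omega> - W s \<omega>) -` B \<inter> space M | B. B \<in> sets borel} \<and>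
        distributed M lborel (\<lambda>\<omega>. W t \<omega> - W s \<omega>)
          (\<lambda>x. ennreal (\<Prod>i\<in>UNIV. normal_density 0 (sqrt (t - s)) (x $ i))))"

text \<open>The pair \<open>(t\<^sub>n, X\<^bsub>t\<^sub>n\<^esub>)\<close>, computed path by path; the step size \<open>h\<close> is \<open>h\<^sup>\<delta>\<close> for one
  fixed \<open>\<delta>\<close>.\<close>

primrec adaptive_state ::
  "(real^'m \<Rightarrow> real^'m) \<Rightarrow> (real^'m \<Rightarrow> real^'d^'m) \<Rightarrow> (real^'m \<Rightarrow> real) \<Rightarrow>
   (real \<Rightarrow> 'w \<Rightarrow> real^'d) \<Rightarrow> ('w \<Rightarrow> real^'m) \<Rightarrow> nat \<Rightarrow> 'w \<Rightarrow> real \<times> (real^'m)" where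
  "adaptive_state f g h W \<xi> 0 \<omega> = (0, \<xi> \<omega>)"
| "adaptive_state f g h W \<xi> (Suc n) \<omega> =
     (let (t, x) = adaptive_state f g h W \<xi> n \<omega>;
          t' = t + h x
      in (t', x + h x *\<^sub>R f x + g x *v (W t' \<omega> - W t \<omega>)))"

definition adaptive_time where
  "adaptive_time f g h W \<xi> n \<omega> = fst (adaptive_state f g h W \<xi> n \<omega>)"

definition adaptive_approx where
  "adaptive_approx f g h W \<xi> n \<omega> = snd (adaptive_state f g h W \<xi> n \<omega>)"

definition assumption_E1 :: "(real^'m \<Rightarrow> real^'m) \<Rightarrow> (real^'m \<Rightarrow> real^'d^'m) \<Rightarrow> bool" where
  "assumption_E1 f g \<longleftrightarrow>
     (\<forall>R>0. \<exists>C>0. \<forall>x y. norm x \<le> R \<and> norm y \<le> R \<longrightarrow>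
        norm (f x - f y) + frobenius_norm (g x - g y) \<le> C * norm (x - y)) \<and>
     (\<exists>\<alpha>>0. \<forall>x. x \<bullet> f x + 1/2 * (frobenius_norm (g x))\<^sup>2 \<le> - \<alpha> * (norm x)\<^sup>2)"

definition assumption_E2 ::
  "(real^'m \<Rightarrow> real^'m) \<Rightarrow> (real^'m \<Rightarrow> real^'d^'m) \<Rightarrow> (real^'m \<Rightarrow> real) \<Rightarrow> bool" where
  "assumption_E2 f g h \<longleftrightarrow>
     continuous_on UNIV h \<and>
     (\<exists>\<alpha>>0. \<forall>x. x \<bullet> f x + real CARD('d) / 2 * (frobenius_norm (g x))\<^sup>2
                   + 1/2 * h x * (norm (f x))\<^sup>2 \<le> - \<alpha> * (norm x)\<^sup>2) \<and>
     (\<exists>hmax>0. \<forall>x. h x \<le> hmax)"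

text \<open>Logarithm of a nonnegative real with the convention \<open>log 0 = -\<infinity>\<close>.\<close>

definition log_ext :: "real \<Rightarrow> ereal" where
  "log_ext r = (if r = 0 then -\<infinity> else ereal (ln r))"

text \<open>The division by \<open>\<tau> n \<omega>\<close> is meaningful only where \<open>\<tau> n \<omega> > 0\<close>; for the
  adaptive time grid this excludes just \<open>n = 0\<close>, which does not affect the limit superior.\<close>

definition as_exponentially_stable ::
  "'w measure \<Rightarrow> (nat \<Rightarrow> 'w \<Rightarrow> real) \<Rightarrow> (nat \<Rightarrow> 'w \<Rightarrow> real^'m) \<Rightarrow> bool" where
  "as_exponentially_stable M \<tau> X \<longleftrightarrow>
     (\<exists>c>0. AE \<omega> in M.
        limsup (\<lambda>n. log_ext (norm (X n \<omega>)) / ereal (\<tau> n \<omega>)) \<le> ereal (- c))"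

end

theory Submission
  imports Defs
begin

text \<open>By Assumption E2, \<open>|x + h(x) f(x)|\<^sup>2 + d h(x) \<parallel>g(x)\<parallel>\<^sup>2 \<le> (1 - 2\<alpha>h(x)) |x|\<^sup>2 \<le> exp(- 2\<alpha>h(x)) |x|\<^sup>2\<close>.
  Hence \<open>Z\<^sub>n = exp(2\<alpha>t\<^sub>n) |X\<^sub>n|\<^sup>2\<close> is a nonnegative supermartingale along the stopping times \<open>t\<^sub>n\<close>, and
  almost surely bounded by some \<open>K\<close>. Then \<open>X\<^sub>n\<close> stays in a ball, on which the continuous positive
  function \<open>h\<close> is bounded away from \<open>0\<close>; so \<open>t\<^sub>n \<rightarrow> \<infinity>\<close> and
  \<open>ln |X\<^sub>n| / t\<^sub>n \<le> ln K / (2t\<^sub>n) - \<alpha>\<close> gives the rate \<open>\<alpha>\<close>.\<close>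

text \<open>The main obstacle: each increment runs over the random interval from \<open>t_n\<close>
  to \<open>t_n + h(X_n)\<close>, whereas Brownian motion is specified by its increments between
  deterministic times. Instead of the full strong Markov property, one inequality for second moments
  is enough, tested against nonnegative weights from the past; it survives discretising both
  endpoints. Likewise the supermartingale property is only ever used integrated over past events, so
  no conditional expectation appears. Reading \<open>W\<close> at random times requires every path
  to be continuous, so \<open>W\<close> is altered on a null set, which the usual conditions place
  in every sigma-algebra of the filtration.

  The factor d in Assumption E2 leaves room for the crude estimate E|A z|^2 \<le> |A|^2 E|z|^2 = d
  \<sigma>^2 |A|^2 for a centred Gaussian z with covariance \<sigma>^2 I, so mixed moments of the
  coordinates are never computed.

  Steps may shrink far from the origin, so divergence of \<open>t_n\<close> cannot be had in
  advance. The weight exp(2 \<alpha> t_n) makes sense without it, and is at least 1 in any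
  case.\<close>

subsection \<open>Gaussian vectors\<close>

text \<open>Both sides are roots of the sum of all squared entries, taken by columns in the trace
  and by rows in the nested Euclidean norm of \<open>real^'d^'m\<close>; hence the exchange of
  sums.\<close>

lemma frobenius_norm_eq_norm: "frobenius_norm A = norm A"
  unfolding frobenius_norm_def norm_eq_sqrt_inner
  by (simp add: trace_def matrix_matrix_mult_def transpose_def inner_vec_def)
     (rule sum.swap)

lemma norm_matrix_vector_mult_le:
  fixes A :: "real^'d^'m"
  shows "norm (A *v x) \<le> norm A * norm x"
proof -
  have "(norm (A *v x))\<^sup>2 = (\<Sum>i\<in>UNIV. (A $ i \<bullet> x)\<^sup>2)"
    unfolding power2_norm_eq_inner
    by (simp add: inner_vec_def[of "A *v x"] matrix_vector_mul_component power2_eq_square)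
  also have "\<dots> \<le> (\<Sum>i\<in>UNIV. (norm (A $ i))\<^sup>2 * (norm x)\<^sup>2)"
    by (intro sum_mono) (metis Cauchy_Schwarz_ineq power2_norm_eq_inner)
  also have "\<dots> = (norm A * norm x)\<^sup>2"
    by (simp add: power_mult_distrib power2_norm_eq_inner inner_vec_def[of A] sum_distrib_right)
  finally show ?thesis
    by (rule power2_le_imp_le) simp
qed

lemma bounded_bilinear_matrix_vector_mult:
  "bounded_bilinear ((*v) :: real^'d^'m \<Rightarrow> real^'d \<Rightarrow> real^'m)"
proof
  show "\<exists>K. \<forall>(A::real^'d^'m) x. norm (A *v x) \<le> norm A * norm x * K"
    by (rule exI[of _ 1]) (simp add: norm_matrix_vector_mult_le)
qed (simp_all add: algebra_simps matrix_vector_mult_scaleR scaleR_matrix_vector_assoc)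

lemma borel_measurable_matrix_vector_mult [measurable (raw)]:
  fixes A :: "'a \<Rightarrow> real^'d^'m"
  assumes "A \<in> borel_measurable M" and "x \<in> borel_measurable M"
  shows "(\<lambda>\<omega>. A \<omega> *v x \<omega>) \<in> borel_measurable M"
  by (rule borel_measurable_continuous_Pair[OF assms])
     (intro bounded_bilinear.continuous_on[OF bounded_bilinear_matrix_vector_mult] continuous_intros)

text \<open>Fubini for coordinates: the product formula for \<open>lborel\<close> is indexed by
  basis vectors, and these are transported to indices along the bijection between \<open>i\<close>
  and \<open>axis i 1\<close>.\<close>

lemma nn_integral_lborel_vec_prod:
  fixes \<phi> :: "'d::finite \<Rightarrow> real \<Rightarrow> ennreal"
  assumes [measurable]: "\<And>i. \<phi> i \<in> borel_measurable borel"
  shows "(\<integral>\<^sup>+x. (\<Prod>i\<in>UNIV. \<phi> i (x $ i)) \<partial>(lborel :: (real^'d) measure))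
    = (\<Prod>i\<in>UNIV. \<integral>\<^sup>+x. \<phi> i x \<partial>lborel)"
proof -
  \<comment> \<open>The index of a basis vector; its value on other vectors is arbitrary.\<close>
  define ix where "ix = (\<lambda>b::real^'d. SOME i. b = axis i 1)"
  have ix: "ix (axis i 1) = i" for i
    unfolding ix_def by (rule some1_equality) (auto simp: axis_eq_axis)
  have Basis: "(Basis :: (real^'d) set) = (\<lambda>i. axis i 1) ` UNIV"
    by (auto simp: Basis_vec_def)
  have inj: "inj (\<lambda>i::'d. axis i (1::real))"
    by (auto simp: inj_on_def axis_eq_axis)
  have "(\<integral>\<^sup>+x. (\<Prod>i\<in>UNIV. \<phi> i (x $ i)) \<partial>(lborel :: (real^'d) measure))
    = (\<integral>\<^sup>+x. (\<Prod>b\<in>Basis. \<phi> (ix b) (x \<bullet> b)) \<partial>lborel)"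
    by (simp add: Basis prod.reindex[OF inj] ix inner_axis)
  also have "\<dots> = (\<Prod>b\<in>Basis. \<integral>\<^sup>+x. \<phi> (ix b) x \<partial>lborel)"
    by (rule nn_integral_lborel_prod) simp_all
  also have "\<dots> = (\<Prod>i\<in>UNIV. \<integral>\<^sup>+x. \<phi> i x \<partial>lborel)"
    by (simp add: Basis prod.reindex[OF inj] ix)
  finally show ?thesis .
qed

lemma nn_integral_lborel_uminus:
  fixes f :: "'a::euclidean_space \<Rightarrow> ennreal"
  assumes [measurable]: "f \<in> borel_measurable borel"
  shows "(\<integral>\<^sup>+x. f (- x) \<partial>lborel) = (\<integral>\<^sup>+x. f x \<partial>lborel)"
  by (subst (2) lborel_affine[where c = "-1" and t = 0])
     (simp_all add: nn_integral_density nn_integral_distr)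

abbreviation gaussian_density :: "real \<Rightarrow> real^'d \<Rightarrow> real" where
  "gaussian_density \<sigma> z \<equiv> \<Prod>i\<in>UNIV. normal_density 0 \<sigma> (z $ i)"

lemma nn_integral_normal_density:
  assumes "0 < \<sigma>"
  shows "(\<integral>\<^sup>+x. ennreal (normal_density 0 \<sigma> x) \<partial>lborel) = 1"
    and "(\<integral>\<^sup>+x. ennreal (normal_density 0 \<sigma> x * x\<^sup>2) \<partial>lborel) = ennreal (\<sigma>\<^sup>2)"
proof -
  show "(\<integral>\<^sup>+x. ennreal (normal_density 0 \<sigma> x) \<partial>lborel) = 1"
    using assms by (subst nn_integral_eq_integral) (auto simp: integral_normal_density integrable_normal_density)
  have "has_bochner_integral lborel (\<lambda>x. normal_density 0 \<sigma> x * x\<^sup>2) (\<sigma>\<^sup>2)"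
    using normal_moment_even[OF assms, of 0 1] by (simp add: fact_numeral)
  then show "(\<integral>\<^sup>+x. ennreal (normal_density 0 \<sigma> x * x\<^sup>2) \<partial>lborel) = ennreal (\<sigma>\<^sup>2)"
    by (subst nn_integral_eq_integral) (auto simp: has_bochner_integral_iff)
qed

lemma nn_integral_gaussian_density:
  assumes "0 < \<sigma>"
  shows "(\<integral>\<^sup>+z. ennreal (gaussian_density \<sigma> z) \<partial>(lborel :: (real^'d) measure)) = 1"
proof -
  have "(\<integral>\<^sup>+z. ennreal (gaussian_density \<sigma> z) \<partial>(lborel :: (real^'d) measure))
    = (\<integral>\<^sup>+z. (\<Prod>i\<in>UNIV. ennreal (normal_density 0 \<sigma> (z $ i))) \<partial>(lborel :: (real^'d) measure))"
    by (simp add: prod_ennreal)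
  also have "\<dots> = 1"
    by (subst nn_integral_lborel_vec_prod) (simp_all add: nn_integral_normal_density[OF assms])
  finally show ?thesis .
qed

lemma nn_integral_gaussian_norm_sq:
  assumes "0 < \<sigma>"
  shows "(\<integral>\<^sup>+z. ennreal (gaussian_density \<sigma> z * (norm z)\<^sup>2) \<partial>(lborel :: (real^'d) measure))
    = ennreal (real CARD('d) * \<sigma>\<^sup>2)"
proof -
  have coord: "(\<integral>\<^sup>+z. ennreal (gaussian_density \<sigma> z * (z $ k)\<^sup>2) \<partial>(lborel :: (real^'d) measure))
    = ennreal (\<sigma>\<^sup>2)" for k
  proof -
    \<comment> \<open>The square is attached to the factor with index \<open>k\<close> and 1 to the
      others, so that the integrand is again a product over coordinates.\<close>
    let ?\<phi> = "\<lambda>i x. ennreal (normal_density 0 \<sigma> x * (if i = k then x\<^sup>2 else 1))"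
    have "(\<integral>\<^sup>+z. ennreal (gaussian_density \<sigma> z * (z $ k)\<^sup>2) \<partial>(lborel :: (real^'d) measure))
      = (\<integral>\<^sup>+z. (\<Prod>i\<in>UNIV. ?\<phi> i (z $ i)) \<partial>(lborel :: (real^'d) measure))"
      by (intro nn_integral_cong, subst prod_ennreal)
         (simp_all add: prod.distrib)
    also have "\<dots> = (\<Prod>i\<in>UNIV. \<integral>\<^sup>+x. ?\<phi> i x \<partial>lborel)"
      by (rule nn_integral_lborel_vec_prod) simp
    also have "\<dots> = (\<Prod>i\<in>UNIV. if i = k then ennreal (\<sigma>\<^sup>2) else 1)"
      by (intro prod.cong) (auto simp: nn_integral_normal_density[OF assms])
    finally show ?thesis by simp
  qed
  have "(\<integral>\<^sup>+z. ennreal (gaussian_density \<sigma> z * (norm z)\<^sup>2) \<partial>(lborel :: (real^'d) measure))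
    = (\<integral>\<^sup>+z. (\<Sum>k\<in>UNIV. ennreal (gaussian_density \<sigma> z * (z $ k)\<^sup>2)) \<partial>(lborel :: (real^'d) measure))"
    by (intro nn_integral_cong, subst sum_ennreal)
       (auto simp: norm_vec_def L2_set_def sum_distrib_left sum_nonneg prod_nonneg)
  also have "\<dots> = (\<Sum>k\<in>(UNIV :: 'd set). ennreal (\<sigma>\<^sup>2))"
    by (subst nn_integral_sum) (simp_all add: coord)
  finally show ?thesis by (simp add: ennreal_mult ennreal_of_nat_eq_real_of_nat)
qed

text \<open>Reflecting \<open>z\<close> and averaging removes the cross term without any integrability argument.\<close>

lemma nn_integral_gaussian_affine_norm_sq_le:
  fixes A :: "real^'d^'m"
  assumes "0 < \<sigma>"
  shows "(\<integral>\<^sup>+z. ennreal (gaussian_density \<sigma> z * (norm (v + A *v z))\<^sup>2) \<partial>lborel)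
    \<le> ennreal ((norm v)\<^sup>2 + real CARD('d) * \<sigma>\<^sup>2 * (norm A)\<^sup>2)" (is "?I \<le> ?R")
proof -
  let ?p = "gaussian_density \<sigma> :: real^'d \<Rightarrow> real"
  let ?q = "\<lambda>z. ennreal (?p z * (norm (v + A *v z))\<^sup>2)"
  have p: "0 \<le> ?p z" for z by (intro prod_nonneg) simp
  have "2 * ?I = ?I + (\<integral>\<^sup>+z. ?q (- z) \<partial>lborel)"
    by (subst nn_integral_lborel_uminus) (simp_all add: mult_2)
  also have "\<dots> = (\<integral>\<^sup>+z. ?q z + ?q (- z) \<partial>lborel)"
    by (subst nn_integral_add) simp_all
  also have "\<dots> \<le> (\<integral>\<^sup>+z. ennreal (2 * (norm v)\<^sup>2) * ennreal (?p z)
      + ennreal (2 * (norm A)\<^sup>2) * ennreal (?p z * (norm z)\<^sup>2) \<partial>lborel)"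
  proof (intro nn_integral_mono)
    fix z
    \<comment> \<open>The parallelogram identity, since
      \<open>A *v (- z) = - (A *v z)\<close>.\<close>
    have "(norm (v + A *v z))\<^sup>2 + (norm (v + A *v (- z)))\<^sup>2 = 2 * (norm v)\<^sup>2 + 2 * (norm (A *v z))\<^sup>2"
      by (simp add: power2_norm_eq_inner algebra_simps inner_commute
          bounded_bilinear.minus_right[OF bounded_bilinear_matrix_vector_mult])
    \<comment> \<open>Here the image of \<open>z\<close> is estimated by the norms alone;
      integrating |z|^2 afterwards produces the factor \<open>CARD('d)\<close>.\<close>
    also have "\<dots> \<le> 2 * (norm v)\<^sup>2 + 2 * (norm A)\<^sup>2 * (norm z)\<^sup>2"
      using power_mono[OF norm_matrix_vector_mult_le[of A z], of 2] by (simp add: power_mult_distrib)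
    finally have "?p z * ((norm (v + A *v z))\<^sup>2 + (norm (v + A *v (- z)))\<^sup>2)
      \<le> ?p z * (2 * (norm v)\<^sup>2 + 2 * (norm A)\<^sup>2 * (norm z)\<^sup>2)"
      by (rule mult_left_mono[OF _ p])
    moreover have "?p (- z) = ?p z" by (simp add: normal_density_def)
    ultimately have "?p z * (norm (v + A *v z))\<^sup>2 + ?p (- z) * (norm (v + A *v (- z)))\<^sup>2
      \<le> 2 * (norm v)\<^sup>2 * ?p z + 2 * (norm A)\<^sup>2 * (?p z * (norm z)\<^sup>2)"
      by (simp add: algebra_simps)
    then show "?q z + ?q (- z) \<le> ennreal (2 * (norm v)\<^sup>2) * ennreal (?p z)
      + ennreal (2 * (norm A)\<^sup>2) * ennreal (?p z * (norm z)\<^sup>2)"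
      using p[of z] p[of "- z"]
      by (simp add: ennreal_mult[symmetric] ennreal_plus[symmetric] del: ennreal_plus)
  qed
  also have "\<dots> = ennreal (2 * (norm v)\<^sup>2) + ennreal (2 * (norm A)\<^sup>2) * ennreal (real CARD('d) * \<sigma>\<^sup>2)"
    by (subst nn_integral_add)
       (simp_all add: nn_integral_cmult nn_integral_gaussian_density[OF assms] nn_integral_gaussian_norm_sq[OF assms])
  also have "\<dots> = 2 * ?R"
    by (simp add: ennreal_mult[symmetric] ennreal_plus[symmetric] ennreal_numeral[symmetric]
        algebra_simps del: ennreal_plus ennreal_numeral)
  finally show ?thesis
    by (rule ennreal_mult_le_mult_iff[THEN iffD1, rotated 2]) simp_all
qed

text \<open>Independence allows \<open>\<omega>\<close> to be frozen in \<open>V\<close>,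
  \<open>A\<close> and \<open>q\<close> while the Gaussian variable is integrated out by the
  deterministic estimate. The past enters as the identity map from \<open>M\<close> to
  \<open>G\<close>, so arbitrary \<open>G\<close>-measurable data are treated at once.\<close>

lemma (in prob_space) nn_integral_independent_gaussian_le:
  fixes \<Delta> :: "'a \<Rightarrow> real^'d" and V :: "'a \<Rightarrow> real^'m" and A :: "'a \<Rightarrow> real^'d^'m"
    and q :: "'a \<Rightarrow> ennreal"
  assumes sub: "subalgebra M G"
    and ind: "indep_set (sets G) {\<Delta> -` B \<inter> space M | B. B \<in> sets borel}"
    and dist: "distributed M lborel \<Delta> (\<lambda>z. ennreal (gaussian_density \<sigma> z))"
    and \<sigma>: "0 < \<sigma>"
    and V [measurable]: "V \<in> borel_measurable G"
    and A [measurable]: "A \<in> borel_measurable G"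
    and q [measurable]: "q \<in> borel_measurable G"
  shows "(\<integral>\<^sup>+\<omega>. q \<omega> * ennreal ((norm (V \<omega> + A \<omega> *v \<Delta> \<omega>))\<^sup>2) \<partial>M)
    \<le> (\<integral>\<^sup>+\<omega>. q \<omega> * ennreal ((norm (V \<omega>))\<^sup>2 + real CARD('d) * \<sigma>\<^sup>2 * (norm (A \<omega>))\<^sup>2) \<partial>M)"
proof -
  have id [measurable]: "(\<lambda>\<omega>. \<omega>) \<in> M \<rightarrow>\<^sub>M G"
    using sub by (auto simp: subalgebra_def measurable_def)
  have \<Delta> [measurable]: "\<Delta> \<in> borel_measurable M"
    using distributed_measurable[OF dist] by simp
  interpret G: prob_space "distr M G (\<lambda>\<omega>. \<omega>)"
    by (rule prob_space_distr) simp
  interpret D: prob_space "distr M borel \<Delta>"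
    by (rule prob_space_distr) simp
  have joint: "distr M G (\<lambda>\<omega>. \<omega>) \<Otimes>\<^sub>M distr M borel \<Delta> = distr M (G \<Otimes>\<^sub>M borel) (\<lambda>\<omega>. (\<omega>, \<Delta> \<omega>))"
  \<comment> \<open>On a rectangle \<open>B \<times> C\<close> the claim is the independence of the
    event \<open>B\<close> and the event that \<open>\<Delta>\<close> lies in
    \<open>C\<close>.\<close>
  proof (rule pair_measure_eqI)
    fix B C assume "B \<in> sets (distr M G (\<lambda>\<omega>. \<omega>))" "C \<in> sets (distr M borel \<Delta>)"
    then have [measurable]: "B \<in> sets G" "C \<in> sets borel" by simp_all
    have B: "B \<subseteq> space M" "B \<in> sets M"
      using sets.sets_into_space[of B G] sub by (auto simp: subalgebra_def)
    have "prob (B \<inter> (\<Delta> -` C \<inter> space M)) = prob B * prob (\<Delta> -` C \<inter> space M)"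
      by (rule indep_setD[OF ind]) auto
    moreover have "B \<inter> (\<Delta> -` C \<inter> space M) = (\<lambda>\<omega>. (\<omega>, \<Delta> \<omega>)) -` (B \<times> C) \<inter> space M"
      using B by auto
    moreover have "(\<lambda>\<omega>. \<omega>) -` B \<inter> space M = B"
      using B by auto
    ultimately show "emeasure (distr M G (\<lambda>\<omega>. \<omega>)) B * emeasure (distr M borel \<Delta>) C
      = emeasure (distr M (G \<Otimes>\<^sub>M borel) (\<lambda>\<omega>. (\<omega>, \<Delta> \<omega>))) (B \<times> C)"
      by (simp add: emeasure_distr emeasure_eq_measure ennreal_mult)
  qed (simp_all add: G.sigma_finite_measure_axioms D.sigma_finite_measure_axioms cong: sets_pair_measure_cong)
  have law: "distr M borel \<Delta> = density lborel (\<lambda>z. ennreal (gaussian_density \<sigma> z))"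
    using distributed_distr_eq_density[OF dist] by (simp cong: distr_cong)
  let ?\<Phi> = "\<lambda>(\<omega>, z). q \<omega> * ennreal ((norm (V \<omega> + A \<omega> *v z))\<^sup>2)"
  have p: "0 \<le> gaussian_density \<sigma> z" for z :: "real^'d" by (intro prod_nonneg) simp
  have inner: "(\<integral>\<^sup>+z. ?\<Phi> (\<omega>, z) \<partial>distr M borel \<Delta>)
      \<le> q \<omega> * ennreal ((norm (V \<omega>))\<^sup>2 + real CARD('d) * \<sigma>\<^sup>2 * (norm (A \<omega>))\<^sup>2)" for \<omega>
  proof -
    have "(\<integral>\<^sup>+z. ?\<Phi> (\<omega>, z) \<partial>distr M borel \<Delta>)
      = (\<integral>\<^sup>+z. ennreal (gaussian_density \<sigma> z) * (q \<omega> * ennreal ((norm (V \<omega> + A \<omega> *v z))\<^sup>2)) \<partial>lborel)"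
      unfolding law by (subst nn_integral_density) simp_all
    also have "\<dots> = (\<integral>\<^sup>+z. q \<omega> * ennreal (gaussian_density \<sigma> z * (norm (V \<omega> + A \<omega> *v z))\<^sup>2) \<partial>lborel)"
      by (intro nn_integral_cong) (simp only: ennreal_mult'[OF p] mult.left_commute)
    also have "\<dots> = q \<omega> * (\<integral>\<^sup>+z. ennreal (gaussian_density \<sigma> z * (norm (V \<omega> + A \<omega> *v z))\<^sup>2) \<partial>lborel)"
      by (rule nn_integral_cmult) simp
    also have "\<dots> \<le> q \<omega> * ennreal ((norm (V \<omega>))\<^sup>2 + real CARD('d) * \<sigma>\<^sup>2 * (norm (A \<omega>))\<^sup>2)"
      by (intro mult_left_mono nn_integral_gaussian_affine_norm_sq_le \<sigma>) simp
    finally show ?thesis .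
  qed
  have "(\<integral>\<^sup>+\<omega>. q \<omega> * ennreal ((norm (V \<omega> + A \<omega> *v \<Delta> \<omega>))\<^sup>2) \<partial>M)
    = (\<integral>\<^sup>+x. ?\<Phi> x \<partial>distr M (G \<Otimes>\<^sub>M borel) (\<lambda>\<omega>. (\<omega>, \<Delta> \<omega>)))"
    by (subst nn_integral_distr) simp_all
  also have "\<dots> = (\<integral>\<^sup>+\<omega>. \<integral>\<^sup>+z. ?\<Phi> (\<omega>, z) \<partial>distr M borel \<Delta> \<partial>distr M G (\<lambda>\<omega>. \<omega>))"
    unfolding joint[symmetric] by (subst D.nn_integral_fst) (simp_all cong: measurable_cong_sets)
  also have "\<dots> \<le> (\<integral>\<^sup>+\<omega>. q \<omega> * ennreal ((norm (V \<omega>))\<^sup>2 + real CARD('d) * \<sigma>\<^sup>2 * (norm (A \<omega>))\<^sup>2) \<partial>distr M G (\<lambda>\<omega>. \<omega>))"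
    by (intro nn_integral_mono inner)
  also have "\<dots> = (\<integral>\<^sup>+\<omega>. q \<omega> * ennreal ((norm (V \<omega>))\<^sup>2 + real CARD('d) * \<sigma>\<^sup>2 * (norm (A \<omega>))\<^sup>2) \<partial>M)"
    by (subst nn_integral_distr) simp_all
  finally show ?thesis .
qed

subsection \<open>Stopping times and supermartingales\<close>

context filtration
begin

text \<open>What is known at time \<open>T\<close> is known at time \<open>t\<close> only where
  \<open>T \<omega> \<le> t\<close>; the constant \<open>c\<close> masks the rest. This turns data
  from the past of a stopping time into data from the past of a fixed time.\<close>

lemma measurable_pre_sigmaD:
  assumes T: "stopping_time F T" and U: "U \<in> pre_sigma T \<rightarrow>\<^sub>M N" and c: "c \<in> space N"
  shows "(\<lambda>\<omega>. if T \<omega> \<le> t then U \<omega> else c) \<in> F t \<rightarrow>\<^sub>M N"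
proof (rule measurableI)
  fix \<omega> assume "\<omega> \<in> space (F t)"
  then show "(if T \<omega> \<le> t then U \<omega> else c) \<in> space N"
    using measurable_space[OF U, of \<omega>] c by (simp add: space_F space_pre_sigma)
next
  fix B assume "B \<in> sets N"
  then have "{\<omega> \<in> U -` B \<inter> \<Omega>. T \<omega> \<le> t} \<in> sets (F t)"
    using sets_pre_sigmaD[OF T, of "U -` B \<inter> \<Omega>" t] measurable_sets[OF U, of B]
    by (simp add: space_pre_sigma)
  moreover have "{\<omega> \<in> space (F t). \<not> T \<omega> \<le> t} \<in> sets (F t)"
    using stopping_timeD[OF T, of t] by (auto simp: pred_def)
  moreover have "(\<lambda>\<omega>. if T \<omega> \<le> t then U \<omega> else c) -` B \<inter> space (F t) = {\<omega> \<in> U -` B \<inter> \<Omega>. T \<omega> \<le> t}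
      \<union> (if c \<in> B then {\<omega> \<in> space (F t). \<not> T \<omega> \<le> t} else {})"
    by (auto simp: space_F split: if_split_asm)
  ultimately show "(\<lambda>\<omega>. if T \<omega> \<le> t then U \<omega> else c) -` B \<inter> space (F t) \<in> sets (F t)"
    by auto
qed

text \<open>The converse of the masking principle: membership in \<open>pre_sigma T\<close> is
  tested on each event \<open>T \<omega> \<le> t\<close>, where the mask is invisible.\<close>

lemma measurable_pre_sigmaI:
  assumes T: "stopping_time F T" and U: "\<And>\<omega>. \<omega> \<in> \<Omega> \<Longrightarrow> U \<omega> \<in> space N"
    and m: "\<And>t. (\<lambda>\<omega>. if T \<omega> \<le> t then U \<omega> else c) \<in> F t \<rightarrow>\<^sub>M N"
  shows "U \<in> pre_sigma T \<rightarrow>\<^sub>M N"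
proof (rule measurableI)
  fix \<omega> assume "\<omega> \<in> space (pre_sigma T)"
  then show "U \<omega> \<in> space N" using U by (simp add: space_pre_sigma)
next
  fix B assume B: "B \<in> sets N"
  show "U -` B \<inter> space (pre_sigma T) \<in> sets (pre_sigma T)"
  proof (rule sets_pre_sigmaI[OF T])
    fix t
    have "{\<omega> \<in> U -` B \<inter> space (pre_sigma T). T \<omega> \<le> t}
      = ((\<lambda>\<omega>. if T \<omega> \<le> t then U \<omega> else c) -` B \<inter> space (F t)) \<inter> {\<omega> \<in> space (F t). T \<omega> \<le> t}"
      by (auto simp: space_pre_sigma space_F)
    also have "\<dots> \<in> sets (F t)"
      using measurable_sets[OF m B] stopping_timeD[OF T, of t] by (auto simp: pred_def)
    finally show "{\<omega> \<in> U -` B \<inter> space (pre_sigma T). T \<omega> \<le> t} \<in> sets (F t)" .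
  qed
qed

end

lemma stopping_time_add:
  fixes T \<eta> :: "'a \<Rightarrow> real"
  assumes "filtration \<Omega> G" and T: "stopping_time G T" and "\<eta> \<in> borel_measurable (filtration.pre_sigma \<Omega> G T)"
    and nonneg: "\<And>\<omega>. \<omega> \<in> \<Omega> \<Longrightarrow> 0 \<le> \<eta> \<omega>"
  shows "stopping_time G (\<lambda>\<omega>. T \<omega> + \<eta> \<omega>)"
proof
  fix t
  interpret G: filtration \<Omega> G by fact
  \<comment> \<open>The default \<open>t + 1\<close> exceeds \<open>t\<close>, as it must: where
    \<open>T \<omega> > t\<close>, the sum with a nonnegative \<open>\<eta> \<omega>\<close> exceeds
    \<open>t\<close> as well.\<close>
  have [measurable]: "(\<lambda>\<omega>. if T \<omega> \<le> t then T \<omega> + \<eta> \<omega> else t + 1) \<in> borel_measurable (G t)"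
    using assms(3) G.measurable_stopping_time_pre_sigma[OF T]
    by (intro G.measurable_pre_sigmaD[OF T]) auto
  have "Measurable.pred (G t) (\<lambda>\<omega>. (if T \<omega> \<le> t then T \<omega> + \<eta> \<omega> else t + 1) \<le> t)"
    by measurable
  then show "Measurable.pred (G t) (\<lambda>\<omega>. T \<omega> + \<eta> \<omega> \<le> t)"
    by (rule measurable_cong[THEN iffD1, rotated]) (use nonneg in \<open>force simp: G.space_F\<close>)
qed

text \<open>Doob's maximal inequality: the probability of ever reaching level c is at most E Z_0 /
  c, which tends to 0 as c grows.\<close>

lemma (in prob_space) nonneg_supermartingale_AE_bounded:
  fixes Z :: "nat \<Rightarrow> 'a \<Rightarrow> real"
  assumes sub: "\<And>n. subalgebra M (G n)" and mono: "\<And>n. sets (G n) \<subseteq> sets (G (Suc n))"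
    and adapted: "\<And>n. Z n \<in> borel_measurable (G n)"
    and super: "\<And>n D. D \<in> sets (G n) \<Longrightarrow>
      (\<integral>\<^sup>+\<omega>. indicator D \<omega> * ennreal (Z (Suc n) \<omega>) \<partial>M) \<le> (\<integral>\<^sup>+\<omega>. indicator D \<omega> * ennreal (Z n \<omega>) \<partial>M)"
    and init: "(\<integral>\<^sup>+\<omega>. ennreal (Z 0 \<omega>) \<partial>M) < \<infinity>"
  shows "AE \<omega> in M. \<exists>K. \<forall>n. Z n \<omega> \<le> K"
proof -
  note [measurable] = measurable_from_subalg[OF sub adapted]
  have space: "space (G n) = space M" for n
    using sub by (simp add: subalgebra_def)
  define D where "D c n = {\<omega> \<in> space M. \<forall>j\<le>n. Z j \<omega> < c}" for c n
  have D_sets: "D c n \<in> sets (G n)" for c n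
  proof (induction n)
    case 0
    show ?case using adapted[of 0] by (simp add: D_def space[of 0, symmetric])
  next
    case (Suc n)
    have "D c (Suc n) = D c n \<inter> {\<omega> \<in> space (G (Suc n)). Z (Suc n) \<omega> < c}"
      by (auto simp: D_def space le_Suc_eq)
    also have "\<dots> \<in> sets (G (Suc n))"
      using Suc mono[of n] adapted[of "Suc n"] by (intro sets.Int) auto
    finally show ?case .
  qed
  have DM [measurable]: "D c n \<in> sets M" for c n
    unfolding D_def by measurable
  have maximal: "ennreal c * emeasure M (space M - D c n) \<le> (\<integral>\<^sup>+\<omega>. ennreal (Z 0 \<omega>) \<partial>M)" for c n
  proof -
    \<comment> \<open>The expectation of the process that is frozen at the value \<open>c\<close>
      once it has reached level \<open>c\<close>; it does not increase with
      \<open>n\<close>.\<close>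
    let ?a = "\<lambda>n. \<integral>\<^sup>+\<omega>. indicator (D c n) \<omega> * ennreal (Z n \<omega>) + ennreal c * indicator (space M - D c n) \<omega> \<partial>M"
    have "?a n \<le> (\<integral>\<^sup>+\<omega>. ennreal (Z 0 \<omega>) \<partial>M)"
    proof (induction n)
      case 0
      show ?case
        by (intro nn_integral_mono) (auto simp: D_def not_less ennreal_leI split: split_indicator)
    next
      case (Suc n)
      \<comment> \<open>Paths that cross exactly at \<open>Suc n\<close> satisfy
        \<open>Z (Suc n) \<omega> \<ge> c\<close>, so counting them with \<open>Z (Suc n)\<close>
        instead of \<open>c\<close> only enlarges the integral; then \<open>super\<close> applies on
        \<open>D c n\<close>.\<close>
      have "?a (Suc n) \<le> (\<integral>\<^sup>+\<omega>. indicator (D c n) \<omega> * ennreal (Z (Suc n) \<omega>) + ennreal c * indicator (space M - D c n) \<omega> \<partial>M)"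
        by (intro nn_integral_mono)
           (auto simp: D_def not_less ennreal_leI le_Suc_eq split: split_indicator)
      also have "\<dots> \<le> ?a n"
        by (subst (1 2) nn_integral_add) (auto intro!: add_right_mono super D_sets)
      finally show ?case using Suc by simp
    qed
    moreover have "ennreal c * emeasure M (space M - D c n) = (\<integral>\<^sup>+\<omega>. ennreal c * indicator (space M - D c n) \<omega> \<partial>M)"
      by (simp add: nn_integral_cmult)
    moreover have "\<dots> \<le> ?a n"
      by (intro nn_integral_mono) simp
    ultimately show ?thesis by simp
  qed
  obtain e where e: "(\<integral>\<^sup>+\<omega>. ennreal (Z 0 \<omega>) \<partial>M) = ennreal e" "0 \<le> e"
    using init by (cases "\<integral>\<^sup>+\<omega>. ennreal (Z 0 \<omega>) \<partial>M") auto
  \<comment> \<open>The event that level \<open>c\<close> is ever reached. The complements of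
    \<open>D c n\<close> increase to it, so the bound for finite horizons passes to the
    limit.\<close>
  define E where "E c = (\<Union>n. space M - D c n)" for c
  have [measurable]: "E c \<in> sets M" for c
    unfolding E_def by measurable
  have E: "emeasure M (E c) \<le> ennreal (e / c)" if "0 < c" for c
  proof -
    have "emeasure M (space M - D c n) \<le> ennreal (e / c)" for n
    proof -
      have "c * measure M (space M - D c n) \<le> e"
        using maximal[of c n] that e by (simp add: emeasure_eq_measure ennreal_mult[symmetric])
      then show ?thesis
        using that by (simp add: emeasure_eq_measure field_simps ennreal_leI)
    qed
    moreover have "emeasure M (E c) = (SUP n. emeasure M (space M - D c n))"
      unfolding E_def
    proof (rule SUP_emeasure_incseq[symmetric])
      show "incseq (\<lambda>n. space M - D c n)"
        by (rule incseq_SucI) (auto simp: D_def)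
    qed auto
    ultimately show ?thesis by (simp add: SUP_least)
  qed
  \<comment> \<open>An unbounded path reaches every level, hence lies in \<open>?N\<close>.\<close>
  let ?N = "\<Inter>k. E (real (Suc k))"
  have "emeasure M ?N = 0"
  proof -
    have "emeasure M ?N \<le> ennreal (e / real (Suc k))" for k
    proof -
      have "emeasure M ?N \<le> emeasure M (E (real (Suc k)))"
        by (intro emeasure_mono) auto
      also have "\<dots> \<le> ennreal (e / real (Suc k))"
        by (rule E) simp
      finally show ?thesis .
    qed
    moreover have "(\<lambda>k. ennreal (e / real (Suc k))) \<longlonglongrightarrow> ennreal 0"
      by (intro tendsto_ennrealI LIMSEQ_Suc[OF lim_const_over_n])
    ultimately have "emeasure M ?N \<le> ennreal 0"
      by (intro LIMSEQ_le_const) auto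
    then show ?thesis by simp
  qed
  then have "?N \<in> null_sets M" by (auto simp: null_sets_def)
  then show ?thesis
  proof (rule AE_I', safe)
    fix \<omega> k assume \<omega>: "\<omega> \<in> space M" and "\<nexists>K. \<forall>n. Z n \<omega> \<le> K"
    then obtain n where "\<not> Z n \<omega> \<le> real (Suc k)" by blast
    with \<omega> have "\<omega> \<in> space M - D (real (Suc k)) n" by (auto simp: D_def not_le)
    then show "\<omega> \<in> E (real (Suc k))" unfolding E_def by blast
  qed
qed

subsection \<open>Brownian increments after a stopping time\<close>

lemma nn_integral_eq_suminf_fibres:
  fixes N :: "'a \<Rightarrow> nat"
  assumes [measurable]: "N \<in> M \<rightarrow>\<^sub>M count_space UNIV" "u \<in> borel_measurable M"
  shows "(\<integral>\<^sup>+\<omega>. u \<omega> \<partial>M) = (\<Sum>n. \<integral>\<^sup>+\<omega>. (if N \<omega> = n then u \<omega> else 0) \<partial>M)"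
proof -
  have "(\<Sum>n. if N \<omega> = n then u \<omega> else 0) = u \<omega>" for \<omega>
    by (subst suminf_finite[of "{N \<omega>}"]) auto
  then have "(\<integral>\<^sup>+\<omega>. u \<omega> \<partial>M) = (\<integral>\<^sup>+\<omega>. (\<Sum>n. if N \<omega> = n then u \<omega> else 0) \<partial>M)"
    by simp
  also have "\<dots> = (\<Sum>n. \<integral>\<^sup>+\<omega>. (if N \<omega> = n then u \<omega> else 0) \<partial>M)"
    by (rule nn_integral_suminf) measurable
  finally show ?thesis .
qed

text \<open>Rounding to mesh 1/(k+1). The lower grid point serves for durations and for times that
  must not pass a deadline, the next one for starting times.\<close>

lemma floor_grid:
  fixes x :: real
  assumes "0 \<le> x"
  shows "real (nat \<lfloor>real (Suc k) * x\<rfloor>) / real (Suc k) \<le> x"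
    and "x < real (nat \<lfloor>real (Suc k) * x\<rfloor> + 1) / real (Suc k)"
proof -
  have n: "real (nat \<lfloor>real (Suc k) * x\<rfloor>) = of_int \<lfloor>real (Suc k) * x\<rfloor>"
    using assms by simp
  have "of_int \<lfloor>real (Suc k) * x\<rfloor> \<le> real (Suc k) * x" "real (Suc k) * x < of_int \<lfloor>real (Suc k) * x\<rfloor> + 1"
    by linarith+
  then show "real (nat \<lfloor>real (Suc k) * x\<rfloor>) / real (Suc k) \<le> x"
    and "x < real (nat \<lfloor>real (Suc k) * x\<rfloor> + 1) / real (Suc k)"
    unfolding of_nat_add n by (simp_all add: field_simps del: of_nat_Suc)
qed

lemma floor_grid_LIMSEQ:
  fixes x :: real
  assumes "0 \<le> x"
  shows "(\<lambda>k. real (nat \<lfloor>real (Suc k) * x\<rfloor>) / real (Suc k)) \<longlonglongrightarrow> x"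
    and "(\<lambda>k. real (nat \<lfloor>real (Suc k) * x\<rfloor> + 1) / real (Suc k)) \<longlonglongrightarrow> x"
proof -
  have inv: "(\<lambda>k. 1 / real (Suc k)) \<longlonglongrightarrow> 0"
    using LIMSEQ_inverse_real_of_nat by (simp add: inverse_eq_divide)
  have split: "real (nat \<lfloor>real (Suc k) * x\<rfloor> + 1) / real (Suc k)
    = real (nat \<lfloor>real (Suc k) * x\<rfloor>) / real (Suc k) + 1 / real (Suc k)" for k
    by (simp add: add_divide_distrib)
  show low: "(\<lambda>k. real (nat \<lfloor>real (Suc k) * x\<rfloor>) / real (Suc k)) \<longlonglongrightarrow> x"
  proof (rule tendsto_sandwich)
    show "\<forall>\<^sub>F k in sequentially. x - 1 / real (Suc k) \<le> real (nat \<lfloor>real (Suc k) * x\<rfloor>) / real (Suc k)"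
    proof (rule always_eventually, rule allI)
      fix k
      show "x - 1 / real (Suc k) \<le> real (nat \<lfloor>real (Suc k) * x\<rfloor>) / real (Suc k)"
        using floor_grid(2)[OF assms, of k] unfolding split by linarith
    qed
    show "\<forall>\<^sub>F k in sequentially. real (nat \<lfloor>real (Suc k) * x\<rfloor>) / real (Suc k) \<le> x"
      by (rule always_eventually) (blast intro: floor_grid(1)[OF assms])
    show "(\<lambda>k. x - 1 / real (Suc k)) \<longlonglongrightarrow> x"
      using tendsto_diff[OF tendsto_const inv, of x] by simp
  qed simp
  show "(\<lambda>k. real (nat \<lfloor>real (Suc k) * x\<rfloor> + 1) / real (Suc k)) \<longlonglongrightarrow> x"
    unfolding split using tendsto_add[OF low inv] by simp
qed

text \<open>Continuity is demanded of every path, so that \<open>W\<close> at a random time is a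
  pointwise limit of its values at discretised times and therefore measurable.\<close>

locale continuous_brownian_motion = prob_space M + filtration "space M" F
  for M :: "'w measure" and F :: "real \<Rightarrow> 'w measure" +
  fixes W :: "real \<Rightarrow> 'w \<Rightarrow> real^'d"
  assumes sets_F_le: "sets (F t) \<subseteq> sets M"
    and adapted: "0 \<le> t \<Longrightarrow> W t \<in> borel_measurable (F t)"
    and continuous_paths: "\<omega> \<in> space M \<Longrightarrow> continuous_on {0..} (\<lambda>t. W t \<omega>)"
    and independent_increments: "0 \<le> s \<Longrightarrow> s < t \<Longrightarrow>
      indep_set (sets (F s)) {(\<lambda>\<omega>. W t \<omega> - W s \<omega>) -` B \<inter> space M | B. B \<in> sets borel}"
    and gaussian_increments: "0 \<le> s \<Longrightarrow> s < t \<Longrightarrow>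
      distributed M lborel (\<lambda>\<omega>. W t \<omega> - W s \<omega>) (\<lambda>x. ennreal (gaussian_density (sqrt (t - s)) x))"
begin

lemma subalgebra_F: "subalgebra M (F t)"
  by (simp add: subalgebra_def space_F sets_F_le)

lemma measurable_W: "0 \<le> t \<Longrightarrow> W t \<in> borel_measurable M"
  by (rule measurable_from_subalg[OF subalgebra_F adapted])

lemma measurable_F_mono:
  "s \<le> t \<Longrightarrow> U \<in> F s \<rightarrow>\<^sub>M N \<Longrightarrow> U \<in> F t \<rightarrow>\<^sub>M N"
  by (erule measurable_from_subalg[rotated]) (simp add: subalgebra_def space_F sets_F_mono)

lemma measurable_W_random_time:
  assumes t: "0 \<le> t" and \<rho> [measurable]: "\<rho> \<in> borel_measurable (F t)"
    and bounds: "\<And>\<omega>. \<omega> \<in> space M \<Longrightarrow> 0 \<le> \<rho> \<omega>" "\<And>\<omega>. \<omega> \<in> space M \<Longrightarrow> \<rho> \<omega> \<le> t"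
  shows "(\<lambda>\<omega>. W (\<rho> \<omega>) \<omega>) \<in> borel_measurable (F t)"
proof (rule borel_measurable_LIMSEQ_metric)
  fix k
  \<comment> \<open>The countable composition needs measurability for every index \<open>i\<close>,
    including grid points beyond \<open>t\<close>; the cap \<open>min t\<close> handles these and is
    inactive at the points actually reached.\<close>
  have W_grid: "W (min t (real i / real (Suc k))) \<in> borel_measurable (F t)" for i
    using t by (intro measurable_F_mono[OF _ adapted]) auto
  show "(\<lambda>\<omega>. W (min t (real (nat \<lfloor>real (Suc k) * \<rho> \<omega>\<rfloor>) / real (Suc k))) \<omega>) \<in> borel_measurable (F t)"
    by (intro measurable_compose_countable[where f = "\<lambda>i \<omega>. W (min t (real i / real (Suc k))) \<omega>"
          and g = "\<lambda>\<omega>. nat \<lfloor>real (Suc k) * \<rho> \<omega>\<rfloor>"] W_grid) measurable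
next
  fix \<omega> assume "\<omega> \<in> space (F t)"
  then have \<omega>: "\<omega> \<in> space M" by (simp add: space_F)
  have "(\<lambda>k. real (nat \<lfloor>real (Suc k) * \<rho> \<omega>\<rfloor>) / real (Suc k)) \<longlonglongrightarrow> \<rho> \<omega>"
    by (rule floor_grid_LIMSEQ(1)[OF bounds(1)[OF \<omega>]])
  moreover have "min t (real (nat \<lfloor>real (Suc k) * \<rho> \<omega>\<rfloor>) / real (Suc k))
      = real (nat \<lfloor>real (Suc k) * \<rho> \<omega>\<rfloor>) / real (Suc k)" for k
    using floor_grid(1)[OF bounds(1)[OF \<omega>], of k] bounds(2)[OF \<omega>] by linarith
  ultimately show "(\<lambda>k. W (min t (real (nat \<lfloor>real (Suc k) * \<rho> \<omega>\<rfloor>) / real (Suc k))) \<omega>) \<longlonglongrightarrow> W (\<rho> \<omega>) \<omega>"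
    using bounds(1)[OF \<omega>] t
    by (intro continuous_on_tendsto_compose[OF continuous_paths[OF \<omega>]]) auto
qed

lemma measurable_W_stopping_time:
  assumes \<tau>: "stopping_time F \<tau>" and nonneg: "\<And>\<omega>. \<omega> \<in> space M \<Longrightarrow> 0 \<le> \<tau> \<omega>"
  shows "(\<lambda>\<omega>. W (\<tau> \<omega>) \<omega>) \<in> borel_measurable (pre_sigma \<tau>)"
proof (rule measurable_pre_sigmaI[OF \<tau>, where c = 0])
  fix t
  show "(\<lambda>\<omega>. if \<tau> \<omega> \<le> t then W (\<tau> \<omega>) \<omega> else 0) \<in> borel_measurable (F t)"
  proof (cases "0 \<le> t")
    case True
    \<comment> \<open>Resetting the time to 0 off \<open>\<tau> \<omega> \<le> t\<close> gives a
      random time with values in [0, t] that is known at time \<open>t\<close>.\<close>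
    have [measurable]: "(\<lambda>\<omega>. if \<tau> \<omega> \<le> t then \<tau> \<omega> else 0) \<in> borel_measurable (F t)"
      by (rule measurable_pre_sigmaD[OF \<tau> measurable_stopping_time_pre_sigma[OF \<tau>]]) simp
    have [measurable]: "(\<lambda>\<omega>. W (if \<tau> \<omega> \<le> t then \<tau> \<omega> else 0) \<omega>) \<in> borel_measurable (F t)"
      by (rule measurable_W_random_time) (use True nonneg in auto)
    have [measurable]: "Measurable.pred (F t) (\<lambda>\<omega>. \<tau> \<omega> \<le> t)"
      by (rule stopping_timeD[OF \<tau>])
    have "(\<lambda>\<omega>. if \<tau> \<omega> \<le> t then W (if \<tau> \<omega> \<le> t then \<tau> \<omega> else 0) \<omega> else 0) \<in> borel_measurable (F t)"
      by measurable
    then show ?thesis by (simp cong: if_cong)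
  next
    case False
    have "(\<lambda>\<omega>. if \<tau> \<omega> \<le> t then W (\<tau> \<omega>) \<omega> else 0) \<in> borel_measurable (F t) \<longleftrightarrow> (\<lambda>\<omega>. 0 :: real^'d) \<in> borel_measurable (F t)"
      by (rule measurable_cong) (use False nonneg in \<open>force simp: space_F\<close>)
    then show ?thesis by simp
  qed
qed simp

text \<open>Since \<open>\<tau>\<close> is finite, each set of its past is a countable union of its
  parts on \<open>\<tau> \<omega> \<le> n\<close>, and each part lies in some
  \<open>F n\<close>.\<close>

lemma subalgebra_pre_sigma:
  assumes \<tau>: "stopping_time F \<tau>"
  shows "subalgebra M (pre_sigma \<tau>)"
  unfolding subalgebra_def
proof (intro conjI subsetI)
  fix A assume A: "A \<in> sets (pre_sigma \<tau>)"
  have "A = (\<Union>n::nat. {\<omega>\<in>A. \<tau> \<omega> \<le> real n})"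
    by (auto intro: real_arch_simple)
  also have "\<dots> \<in> sets M"
    using sets_pre_sigmaD[OF \<tau> A] sets_F_le by blast
  finally show "A \<in> sets M" .
qed (simp add: space_pre_sigma)

lemma nn_integral_increment_le:
  fixes V :: "'w \<Rightarrow> real^'m" and A :: "'w \<Rightarrow> real^'d^'m" and q :: "'w \<Rightarrow> ennreal"
  assumes "0 \<le> a" "0 \<le> b"
    and "V \<in> borel_measurable (F a)" "A \<in> borel_measurable (F a)" "q \<in> borel_measurable (F a)"
  shows "(\<integral>\<^sup>+\<omega>. q \<omega> * ennreal ((norm (V \<omega> + A \<omega> *v (W (a + b) \<omega> - W a \<omega>)))\<^sup>2) \<partial>M)
    \<le> (\<integral>\<^sup>+\<omega>. q \<omega> * ennreal ((norm (V \<omega>))\<^sup>2 + real CARD('d) * b * (norm (A \<omega>))\<^sup>2) \<partial>M)"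
\<comment> \<open>A duration rounded down to the grid may be 0, where no Gaussian density is
  available; both sides then coincide.\<close>
proof (cases "b = 0")
  case False
  with assms have b: "0 < b" by simp
  show ?thesis
    using nn_integral_independent_gaussian_le[OF subalgebra_F independent_increments[of a "a + b"]
        gaussian_increments[of a "a + b"], of V A q] assms b
    by simp
qed simp

text \<open>The strong Markov property in integrated form: \<open>\<tau>\<close> is approximated from the right, so that
  the increment after a grid point is independent of the past, and \<open>\<eta>\<close> from the left, so that the
  discretised variances stay below \<open>\<eta>\<close> and Fatou's lemma suffices for the limit.\<close>

lemma nn_integral_stopped_increment_le:
  fixes V :: "'w \<Rightarrow> real^'m" and A :: "'w \<Rightarrow> real^'d^'m" and q :: "'w \<Rightarrow> ennreal"
  assumes \<tau>: "stopping_time F \<tau>" and \<tau>_nonneg: "\<And>\<omega>. \<omega> \<in> space M \<Longrightarrow> 0 \<le> \<tau> \<omega>"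
    and \<eta>: "\<eta> \<in> borel_measurable (pre_sigma \<tau>)" and \<eta>_nonneg: "\<And>\<omega>. \<omega> \<in> space M \<Longrightarrow> 0 \<le> \<eta> \<omega>"
    and V: "V \<in> borel_measurable (pre_sigma \<tau>)" and A: "A \<in> borel_measurable (pre_sigma \<tau>)"
    and q: "q \<in> borel_measurable (pre_sigma \<tau>)" and q_finite: "\<And>\<omega>. \<omega> \<in> space M \<Longrightarrow> q \<omega> < \<top>"
  shows "(\<integral>\<^sup>+\<omega>. q \<omega> * ennreal ((norm (V \<omega> + A \<omega> *v (W (\<tau> \<omega> + \<eta> \<omega>) \<omega> - W (\<tau> \<omega>) \<omega>)))\<^sup>2) \<partial>M)
    \<le> (\<integral>\<^sup>+\<omega>. q \<omega> * ennreal ((norm (V \<omega>))\<^sup>2 + real CARD('d) * \<eta> \<omega> * (norm (A \<omega>))\<^sup>2) \<partial>M)"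
    (is "?L \<le> (\<integral>\<^sup>+\<omega>. ?R \<omega> \<partial>M)")
proof -
  note \<tau>_pre = measurable_stopping_time_pre_sigma[OF \<tau>]
  note [measurable] = measurable_from_subalg[OF subalgebra_pre_sigma[OF \<tau>] \<eta>]
    measurable_from_subalg[OF subalgebra_pre_sigma[OF \<tau>] V]
    measurable_from_subalg[OF subalgebra_pre_sigma[OF \<tau>] A]
    measurable_from_subalg[OF subalgebra_pre_sigma[OF \<tau>] q]
    measurable_from_subalg[OF subalgebra_pre_sigma[OF \<tau>] \<tau>_pre]
  define i where "i k \<omega> = nat \<lfloor>real (Suc k) * \<tau> \<omega>\<rfloor>" for k \<omega>
  define j where "j k \<omega> = nat \<lfloor>real (Suc k) * \<eta> \<omega>\<rfloor>" for k \<omega>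
  define a where "a k i = real (i + 1) / real (Suc k)" for k i
  define b where "b k j = real j / real (Suc k)" for k j
  \<comment> \<open>Both grid indices are packed into one natural number, so that a single countable
    partition makes starting point and duration deterministic on each fibre.\<close>
  define N where "N k \<omega> = prod_encode (i k \<omega>, j k \<omega>)" for k \<omega>
  define \<Delta> where "\<Delta> k n = (\<lambda>\<omega>. W (a k (fst (prod_decode n)) + b k (snd (prod_decode n))) \<omega> - W (a k (fst (prod_decode n))) \<omega>)" for k n
  define u where "u k \<omega> = q \<omega> * ennreal ((norm (V \<omega> + A \<omega> *v \<Delta> k (N k \<omega>) \<omega>))\<^sup>2)" for k \<omega>
  have ab: "0 \<le> a k i" "0 \<le> b k i" for k i by (simp_all add: a_def b_def)
  have N_pre: "N k \<in> pre_sigma \<tau> \<rightarrow>\<^sub>M count_space UNIV" for k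
    using \<tau>_pre \<eta> unfolding N_def i_def j_def by measurable
  note [measurable] = measurable_from_subalg[OF subalgebra_pre_sigma[OF \<tau>] N_pre]
  have [measurable]: "\<Delta> k n \<in> borel_measurable M" for k n
    unfolding \<Delta>_def by (intro borel_measurable_diff measurable_W) (simp_all add: ab)
  have [measurable]: "(\<lambda>\<omega>. \<Delta> k (N k \<omega>) \<omega>) \<in> borel_measurable M" for k
    by (rule measurable_compose_countable) measurable
  have [measurable]: "u k \<in> borel_measurable M" for k
    unfolding u_def by measurable
  have u_le: "(\<integral>\<^sup>+\<omega>. u k \<omega> \<partial>M) \<le> (\<integral>\<^sup>+\<omega>. ?R \<omega> \<partial>M)" for k
  proof -
    have "(\<integral>\<^sup>+\<omega>. (if N k \<omega> = n then u k \<omega> else 0) \<partial>M) \<le> (\<integral>\<^sup>+\<omega>. (if N k \<omega> = n then ?R \<omega> else 0) \<partial>M)" for n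
    proof -
      obtain i' j' where n: "prod_decode n = (i', j')" by fastforce
      let ?a = "a k i'" and ?b = "b k j'"
      have on_fibre: "\<tau> \<omega> \<le> ?a" "?b \<le> \<eta> \<omega>" if "N k \<omega> = n" "\<omega> \<in> space M" for \<omega>
      proof -
        have "i k \<omega> = i'" "j k \<omega> = j'"
          using that n by (auto simp: N_def)
        then show "\<tau> \<omega> \<le> ?a" "?b \<le> \<eta> \<omega>"
          using floor_grid(2)[OF \<tau>_nonneg, of \<omega> k] floor_grid(1)[OF \<eta>_nonneg, of \<omega> k] that
          by (auto simp: a_def b_def i_def j_def)
      qed
      \<comment> \<open>Masking on \<open>\<tau> \<omega> \<le> ?a\<close> makes the data measurable
        at the fixed time \<open>?a\<close>; on the fibre this condition holds anyway, and
        \<open>q'\<close> vanishes off the fibre.\<close>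
      define V' where "V' \<omega> = (if \<tau> \<omega> \<le> ?a then V \<omega> else 0)" for \<omega>
      define A' where "A' \<omega> = (if \<tau> \<omega> \<le> ?a then A \<omega> else 0)" for \<omega>
      define q' where "q' \<omega> = (if \<tau> \<omega> \<le> ?a then (if N k \<omega> = n then q \<omega> else 0) else 0)" for \<omega>
      have meas: "V' \<in> borel_measurable (F ?a)" "A' \<in> borel_measurable (F ?a)" "q' \<in> borel_measurable (F ?a)"
        unfolding V'_def A'_def q'_def using V A q N_pre[of k]
        by (intro measurable_pre_sigmaD[OF \<tau>]; simp; measurable)+
      have "(\<integral>\<^sup>+\<omega>. (if N k \<omega> = n then u k \<omega> else 0) \<partial>M)
        = (\<integral>\<^sup>+\<omega>. q' \<omega> * ennreal ((norm (V' \<omega> + A' \<omega> *v (W (?a + ?b) \<omega> - W ?a \<omega>)))\<^sup>2) \<partial>M)"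
        using on_fibre(1)
        by (intro nn_integral_cong) (auto simp: u_def \<Delta>_def n V'_def A'_def q'_def)
      also have "\<dots> \<le> (\<integral>\<^sup>+\<omega>. q' \<omega> * ennreal ((norm (V' \<omega>))\<^sup>2 + real CARD('d) * ?b * (norm (A' \<omega>))\<^sup>2) \<partial>M)"
        by (rule nn_integral_increment_le[OF ab meas])
      also have "\<dots> \<le> (\<integral>\<^sup>+\<omega>. (if N k \<omega> = n then ?R \<omega> else 0) \<partial>M)"
      proof (rule nn_integral_mono)
        fix \<omega> assume \<omega>: "\<omega> \<in> space M"
        show "q' \<omega> * ennreal ((norm (V' \<omega>))\<^sup>2 + real CARD('d) * ?b * (norm (A' \<omega>))\<^sup>2)
          \<le> (if N k \<omega> = n then ?R \<omega> else 0)"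
        proof (cases "N k \<omega> = n")
          case True
          have "(norm (V \<omega>))\<^sup>2 + real CARD('d) * ?b * (norm (A \<omega>))\<^sup>2
            \<le> (norm (V \<omega>))\<^sup>2 + real CARD('d) * \<eta> \<omega> * (norm (A \<omega>))\<^sup>2"
            using on_fibre(2)[OF True \<omega>] by (intro add_left_mono mult_right_mono mult_left_mono) auto
          then show ?thesis
            using True on_fibre(1)[OF True \<omega>]
            by (simp add: V'_def A'_def q'_def mult_left_mono ennreal_leI)
        qed (simp add: q'_def)
      qed
      finally show ?thesis .
    qed
    then show ?thesis
      by (subst (1 2) nn_integral_eq_suminf_fibres[of "N k"]) (auto intro!: suminf_le)
  qed
  have limit: "(\<lambda>k. u k \<omega>) \<longlonglongrightarrow> q \<omega> * ennreal ((norm (V \<omega> + A \<omega> *v (W (\<tau> \<omega> + \<eta> \<omega>) \<omega> - W (\<tau> \<omega>) \<omega>)))\<^sup>2)"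
    if \<omega>: "\<omega> \<in> space M" for \<omega>
  proof -
    have a: "(\<lambda>k. a k (i k \<omega>)) \<longlonglongrightarrow> \<tau> \<omega>"
      unfolding a_def i_def by (rule floor_grid_LIMSEQ(2)[OF \<tau>_nonneg[OF \<omega>]])
    have b: "(\<lambda>k. b k (j k \<omega>)) \<longlonglongrightarrow> \<eta> \<omega>"
      unfolding b_def j_def by (rule floor_grid_LIMSEQ(1)[OF \<eta>_nonneg[OF \<omega>]])
    have Wa: "(\<lambda>k. W (a k (i k \<omega>)) \<omega>) \<longlonglongrightarrow> W (\<tau> \<omega>) \<omega>"
      using \<tau>_nonneg[OF \<omega>] ab
      by (intro continuous_on_tendsto_compose[OF continuous_paths[OF \<omega>] a]) auto
    have Wab: "(\<lambda>k. W (a k (i k \<omega>) + b k (j k \<omega>)) \<omega>) \<longlonglongrightarrow> W (\<tau> \<omega> + \<eta> \<omega>) \<omega>"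
      using \<tau>_nonneg[OF \<omega>] \<eta>_nonneg[OF \<omega>] ab
      by (intro continuous_on_tendsto_compose[OF continuous_paths[OF \<omega>] tendsto_add[OF a b]]) auto
    have "(\<lambda>k. \<Delta> k (N k \<omega>) \<omega>) \<longlonglongrightarrow> W (\<tau> \<omega> + \<eta> \<omega>) \<omega> - W (\<tau> \<omega>) \<omega>"
      unfolding \<Delta>_def N_def prod_encode_inverse fst_conv snd_conv by (rule tendsto_diff[OF Wab Wa])
    \<comment> \<open>Finiteness of \<open>q\<close> enters here: multiplication by \<infinity> is
      not continuous at 0.\<close>
    then show ?thesis
      unfolding u_def
      by (intro ennreal_tendsto_cmult[OF q_finite[OF \<omega>]] tendsto_ennrealI tendsto_power tendsto_norm
          tendsto_add tendsto_const bounded_bilinear.tendsto[OF bounded_bilinear_matrix_vector_mult])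
  qed
  have "?L = (\<integral>\<^sup>+\<omega>. liminf (\<lambda>k. u k \<omega>) \<partial>M)"
    by (intro nn_integral_cong lim_imp_Liminf[symmetric] limit) simp
  also have "\<dots> \<le> liminf (\<lambda>k. \<integral>\<^sup>+\<omega>. u k \<omega> \<partial>M)"
    by (rule nn_integral_liminf) simp
  also have "\<dots> \<le> (\<integral>\<^sup>+\<omega>. ?R \<omega> \<partial>M)"
    using u_le by (intro Liminf_le) auto
  finally show ?thesis .
qed

end

section \<open>Passing to a modification with continuous paths\<close>

lemma (in prob_space) indep_set_vimage_AE_cong:
  fixes X Y :: "'a \<Rightarrow> 'b::topological_space"
  assumes ind: "indep_set \<A> {X -` B \<inter> space M | B. B \<in> sets borel}"
    and eq: "AE \<omega> in M. X \<omega> = Y \<omega>" and [measurable]: "X \<in> borel_measurable M" "Y \<in> borel_measurable M"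
  shows "indep_set \<A> {Y -` B \<inter> space M | B. B \<in> sets borel}"
proof (rule indep_setI)
  have \<A>: "\<A> \<subseteq> events" using ind by (simp add: indep_sets2_eq)
  then show "\<A> \<subseteq> events" .
  show "{Y -` B \<inter> space M | B. B \<in> sets borel} \<subseteq> events" by auto
  fix A C assume A: "A \<in> \<A>" and "C \<in> {Y -` B \<inter> space M | B. B \<in> sets borel}"
  then obtain B where C: "C = Y -` B \<inter> space M" and [measurable]: "B \<in> sets borel" by blast
  have [measurable]: "A \<in> events" using A \<A> by blast
  have "prob (A \<inter> C) = prob (A \<inter> (X -` B \<inter> space M))"
    unfolding C by (rule finite_measure_eq_AE) (use eq in auto)
  also have "\<dots> = prob A * prob (X -` B \<inter> space M)"
    by (rule indep_setD[OF ind A]) auto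
  also have "prob (X -` B \<inter> space M) = prob C"
    unfolding C by (rule finite_measure_eq_AE) (use eq in auto)
  finally show "prob (A \<inter> C) = prob A * prob C" .
qed

lemma distributed_AE_cong:
  assumes dist: "distributed M N X p" and eq: "AE \<omega> in M. X \<omega> = Y \<omega>" and Y: "Y \<in> M \<rightarrow>\<^sub>M N"
  shows "distributed M N Y p"
proof -
  have "distr M N Y = distr M N X"
    using eq Y distributed_measurable[OF dist] by (intro distr_cong_AE) auto
  then show ?thesis using dist Y by (simp add: distributed_def)
qed

text \<open>Filtrations of the library are indexed by the whole type \<^typ>\<open>real\<close>, hence \<open>max 0 t\<close>.\<close>

lemma brownian_motion_continuous_modification:
  fixes W :: "real \<Rightarrow> 'w \<Rightarrow> real^'d"
  assumes "prob_space M" and usual: "usual_filtration M F" and bm: "standard_brownian_motion M F W"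
  obtains W' where "continuous_brownian_motion M (\<lambda>t. F (max 0 t)) W'"
    and "AE \<omega> in M. \<forall>t. W' t \<omega> = W t \<omega>"
proof -
  interpret prob_space M by fact
  have sub: "subalgebra M (F t)" if "0 \<le> t" for t
    using usual that unfolding usual_filtration_def by blast
  have mono: "sets (F s) \<subseteq> sets (F t)" if "0 \<le> s" "s \<le> t" for s t
    using usual that unfolding usual_filtration_def by blast
  have "AE \<omega> in M. continuous_on {0..} (\<lambda>t. W t \<omega>)"
    using bm by (simp add: standard_brownian_motion_def)
  then obtain N where N: "N \<in> null_sets M" "{\<omega> \<in> space M. \<not> continuous_on {0..} (\<lambda>t. W t \<omega>)} \<subseteq> N"
    by (auto simp: eventually_ae_filter)
  \<comment> \<open>Exceptional paths are replaced by the zero path, which is continuous.\<close>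
  define W' where "W' t \<omega> = (if \<omega> \<in> N then 0 else W t \<omega>)" for t \<omega>
  have eq: "AE \<omega> in M. \<forall>t. W' t \<omega> = W t \<omega>"
    using AE_not_in[OF N(1)] by eventually_elim (simp add: W'_def)
  have adapted: "W' t \<in> borel_measurable (F t)" if t: "0 \<le> t" for t
  proof -
    have [measurable]: "W t \<in> borel_measurable (F t)"
      using bm t by (simp add: standard_brownian_motion_def)
    \<comment> \<open>Adaptedness of \<open>W'\<close> rests on this: null sets belong to
      \<open>F 0\<close>, hence to every later \<open>F t\<close>.\<close>
    have [measurable]: "N \<in> sets (F t)"
      using N(1) usual mono[of 0 t] t unfolding usual_filtration_def by blast
    show ?thesis unfolding W'_def by measurable
  qed
  have meas: "W t \<in> borel_measurable M" "W' t \<in> borel_measurable M" if "0 \<le> t" for t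
    using measurable_from_subalg[OF sub[OF that]] adapted[OF that] bm that
    by (auto simp: standard_brownian_motion_def)
  have incr_eq: "AE \<omega> in M. W t \<omega> - W s \<omega> = W' t \<omega> - W' s \<omega>" for s t
    using eq by eventually_elim simp
  have "continuous_brownian_motion M (\<lambda>t. F (max 0 t)) W'"
  proof
    show "space (F (max 0 t)) = space M" "sets (F (max 0 t)) \<subseteq> sets M" for t
      using sub[of "max 0 t"] by (simp_all add: subalgebra_def)
    show "sets (F (max 0 s)) \<subseteq> sets (F (max 0 t))" if "s \<le> t" for s t
      using that by (intro mono) auto
    show "W' t \<in> borel_measurable (F (max 0 t))" if "0 \<le> t" for t
      using adapted[OF that] that by (simp add: max_absorb2)
    show "continuous_on {0..} (\<lambda>t. W' t \<omega>)" if "\<omega> \<in> space M" for \<omega>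
      using N(2) that by (cases "\<omega> \<in> N") (auto simp: W'_def)
    fix s t :: real assume st: "0 \<le> s" "s < t"
    show "indep_set (sets (F (max 0 s))) {(\<lambda>\<omega>. W' t \<omega> - W' s \<omega>) -` B \<inter> space M | B. B \<in> sets borel}"
      using bm st meas[of s] meas[of t]
      by (intro indep_set_vimage_AE_cong[OF _ incr_eq])
         (auto simp: standard_brownian_motion_def max_absorb2)
    show "distributed M lborel (\<lambda>\<omega>. W' t \<omega> - W' s \<omega>) (\<lambda>x. ennreal (gaussian_density (sqrt (t - s)) x))"
      using bm st meas[of s] meas[of t]
      by (intro distributed_AE_cong[OF _ incr_eq]) (auto simp: standard_brownian_motion_def)
  qed
  with eq that show thesis by blast
qed

subsection \<open>The adaptive scheme\<close>

lemma adaptive_time_0 [simp]: "adaptive_time f g h W \<xi> 0 \<omega> = 0"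
  and adaptive_approx_0 [simp]: "adaptive_approx f g h W \<xi> 0 \<omega> = \<xi> \<omega>"
  and adaptive_time_Suc [simp]: "adaptive_time f g h W \<xi> (Suc n) \<omega> =
    adaptive_time f g h W \<xi> n \<omega> + h (adaptive_approx f g h W \<xi> n \<omega>)"
  by (simp_all add: adaptive_time_def adaptive_approx_def case_prod_unfold Let_def)

lemma adaptive_approx_Suc:
  "adaptive_approx f g h W \<xi> (Suc n) \<omega> =
    adaptive_approx f g h W \<xi> n \<omega>
    + h (adaptive_approx f g h W \<xi> n \<omega>) *\<^sub>R f (adaptive_approx f g h W \<xi> n \<omega>)
    + g (adaptive_approx f g h W \<xi> n \<omega>) *v
      (W (adaptive_time f g h W \<xi> n \<omega> + h (adaptive_approx f g h W \<xi> n \<omega>)) \<omega> - W (adaptive_time f g h W \<xi> n \<omega>) \<omega>)"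
  by (simp add: adaptive_time_def adaptive_approx_def case_prod_unfold Let_def)

text \<open>The times at which the scheme reads the path depend on the path, so agreement at all
  times simultaneously is the right hypothesis.\<close>

lemma adaptive_state_cong:
  assumes "\<And>t. W t \<omega> = W' t \<omega>"
  shows "adaptive_state f g h W \<xi> n \<omega> = adaptive_state f g h W' \<xi> n \<omega>"
  by (induction n) (simp_all add: assms case_prod_unfold Let_def)

lemma adaptive_time_nonneg:
  assumes "\<And>x. 0 < h x"
  shows "0 \<le> adaptive_time f g h W \<xi> n \<omega>"
  by (induction n) (simp_all add: assms less_imp_le)

section \<open>The decay rate of a single path\<close>

lemma limsup_log_norm_le:
  fixes x :: "nat \<Rightarrow> 'a::euclidean_space" and t :: "nat \<Rightarrow> real"
  assumes h: "continuous_on UNIV h" "\<And>y. 0 < h y"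
    and t: "t 0 = 0" "\<And>n. t (Suc n) = t n + h (x n)"
    and bound: "\<And>n. exp (2 * \<alpha> * t n) * (norm (x n))\<^sup>2 \<le> K" and \<alpha>: "0 < \<alpha>"
  shows "limsup (\<lambda>n. log_ext (norm (x n)) / ereal (t n)) \<le> ereal (- \<alpha>)"
proof -
  have t_nonneg: "0 \<le> t n" for n
    by (induction n) (simp_all add: t h less_imp_le)
  have "0 \<le> K"
    using bound[of 0] by (rule order_trans[rotated]) simp
  have "norm (x n) \<le> sqrt K" for n
  proof -
    have "1 * (norm (x n))\<^sup>2 \<le> exp (2 * \<alpha> * t n) * (norm (x n))\<^sup>2"
      using t_nonneg[of n] \<alpha> by (intro mult_right_mono) auto
    then have "(norm (x n))\<^sup>2 \<le> K" using bound[of n] by simp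
    then show ?thesis by (simp add: real_le_rsqrt)
  qed
  then have x_ball: "x n \<in> cball 0 (sqrt K)" for n by simp
  obtain y where y: "\<And>z. z \<in> cball 0 (sqrt K) \<Longrightarrow> h y \<le> h z"
    using continuous_attains_inf[of "cball 0 (sqrt K)" h] x_ball h(1)
    by (metis compact_cball continuous_on_subset empty_iff subset_UNIV)
  have t_ge: "real n * h y \<le> t n" for n
  proof (induction n)
    case (Suc n)
    then show ?case using y[OF x_ball[of n]] by (simp add: t algebra_simps)
  qed (simp add: t)
  have "filterlim (\<lambda>n. real n * h y) at_top sequentially"
    using h(2)[of y] by (intro filterlim_at_top_mult_tendsto_pos[OF tendsto_const _ filterlim_real_sequentially])
  then have t_lim: "filterlim t at_top sequentially"
    by (rule filterlim_at_top_mono) (simp add: t_ge)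
  \<comment> \<open>The maximum with 1 keeps the logarithm monotone in the comparison even if
    \<open>K\<close> is 0.\<close>
  define L where "L = ln (max K 1) / 2"
  have le: "log_ext (norm (x n)) / ereal (t n) \<le> ereal (L / t n - \<alpha>)" if tn: "0 < t n" for n
  \<comment> \<open>At \<open>x n = 0\<close> the quotient is -\<infinity>, so only nonzero points
    need the estimate.\<close>
  proof (cases "x n = 0")
    case False
    then have "ln (exp (2 * \<alpha> * t n) * (norm (x n))\<^sup>2) \<le> ln (max K 1)"
      using bound[of n] by (subst ln_le_cancel_iff) auto
    moreover have "ln (exp (2 * \<alpha> * t n) * (norm (x n))\<^sup>2) = 2 * \<alpha> * t n + 2 * ln (norm (x n))"
      using False by (simp add: ln_mult ln_realpow)
    ultimately have "ln (norm (x n)) \<le> L - \<alpha> * t n" by (simp add: L_def)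
    then have "ln (norm (x n)) / t n \<le> L / t n - \<alpha>"
      using tn by (simp add: field_simps)
    then show ?thesis using False tn by (simp add: log_ext_def)
  qed (use tn in \<open>simp add: log_ext_def\<close>)
  have "((\<lambda>n. L / t n - \<alpha>) \<longlongrightarrow> 0 - \<alpha>) sequentially"
    by (intro tendsto_intros real_tendsto_divide_at_top[OF tendsto_const t_lim])
  then have "limsup (\<lambda>n. ereal (L / t n - \<alpha>)) = ereal (- \<alpha>)"
    by (intro lim_imp_Limsup) auto
  \<comment> \<open>The comparison requires \<open>0 < t n\<close>, which fails at
    \<open>n = 0\<close> but holds eventually because \<open>t\<close> diverges.\<close>
  moreover have "limsup (\<lambda>n. log_ext (norm (x n)) / ereal (t n)) \<le> limsup (\<lambda>n. ereal (L / t n - \<alpha>))"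
    using t_lim by (intro Limsup_mono) (auto simp: filterlim_at_top_dense elim!: allE[of _ 0] eventually_mono intro: le)
  ultimately show ?thesis by simp
qed

section \<open>Adaptedness and the supermartingale estimate for the scheme\<close>

context continuous_brownian_motion
begin

text \<open>The two claims need a joint induction: the step size is a function of the current state,
  so it is known at the current time and the next time is a stopping time; only then is
  \<open>W\<close> at that time, and with it the next state, known there.\<close>

lemma adaptive_scheme_adapted:
  fixes f :: "real^'m \<Rightarrow> real^'m" and g :: "real^'m \<Rightarrow> real^'d^'m"
  assumes f: "f \<in> borel_measurable borel" and g: "g \<in> borel_measurable borel"
    and h: "h \<in> borel_measurable borel" and h_pos: "\<And>x. 0 < h x"
    and \<xi>: "\<xi> \<in> borel_measurable (F 0)"
  shows "stopping_time F (adaptive_time f g h W \<xi> n)"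
    and "adaptive_approx f g h W \<xi> n \<in> borel_measurable (pre_sigma (adaptive_time f g h W \<xi> n))"
proof (induction n)
  note [measurable] = f g h
  case 0
  have T0: "adaptive_time f g h W \<xi> 0 = (\<lambda>\<omega>. 0)" and X0: "adaptive_approx f g h W \<xi> 0 = \<xi>"
    by auto
  show "stopping_time F (adaptive_time f g h W \<xi> 0)"
    unfolding T0 by (rule stopping_time_const)
  show "adaptive_approx f g h W \<xi> 0 \<in> borel_measurable (pre_sigma (adaptive_time f g h W \<xi> 0))"
    unfolding T0 X0
  proof (rule measurable_pre_sigmaI[OF stopping_time_const, where c = 0])
    show "(\<lambda>\<omega>. if 0 \<le> t then \<xi> \<omega> else 0) \<in> borel_measurable (F t)" for t :: real
      by (cases "0 \<le> t") (simp_all add: measurable_F_mono[OF _ \<xi>])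
  qed simp
next
  case (Suc n)
  note [measurable] = f g h
  let ?T = "adaptive_time f g h W \<xi>" and ?X = "adaptive_approx f g h W \<xi>"
  have X: "?X n \<in> borel_measurable (pre_sigma (?T n))" by (rule Suc(2))
  then have hX: "(\<lambda>\<omega>. h (?X n \<omega>)) \<in> borel_measurable (pre_sigma (?T n))" by measurable
  have T_Suc: "?T (Suc n) = (\<lambda>\<omega>. ?T n \<omega> + h (?X n \<omega>))" by auto
  show stop: "stopping_time F (?T (Suc n))"
    unfolding T_Suc
    by (rule stopping_time_add[OF filtration_axioms Suc(1) hX]) (simp add: h_pos less_imp_le)
  have sub: "subalgebra (pre_sigma (?T (Suc n))) (pre_sigma (?T n))"
    unfolding subalgebra_def space_pre_sigma
    using mono_pre_sigma[OF Suc(1) stop] by (simp add: h_pos less_imp_le)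
  have [measurable]: "?X n \<in> borel_measurable (pre_sigma (?T (Suc n)))"
    by (rule measurable_from_subalg[OF sub X])
  have [measurable]: "(\<lambda>\<omega>. W (?T n \<omega>) \<omega>) \<in> borel_measurable (pre_sigma (?T (Suc n)))"
    by (rule measurable_from_subalg[OF sub measurable_W_stopping_time[OF Suc(1)]])
       (simp add: adaptive_time_nonneg[OF h_pos])
  have "(\<lambda>\<omega>. W (?T (Suc n) \<omega>) \<omega>) \<in> borel_measurable (pre_sigma (?T (Suc n)))"
    by (rule measurable_W_stopping_time[OF stop]) (rule adaptive_time_nonneg[OF h_pos])
  then have [measurable]: "(\<lambda>\<omega>. W (?T n \<omega> + h (?X n \<omega>)) \<omega>) \<in> borel_measurable (pre_sigma (?T (Suc n)))"
    by simp
  have "?X (Suc n) = (\<lambda>\<omega>. ?X n \<omega> + h (?X n \<omega>) *\<^sub>R f (?X n \<omega>)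
      + g (?X n \<omega>) *v (W (?T n \<omega> + h (?X n \<omega>)) \<omega> - W (?T n \<omega>) \<omega>))"
    by (rule ext) (rule adaptive_approx_Suc)
  also have "\<dots> \<in> borel_measurable (pre_sigma (?T (Suc n)))"
    by measurable
  finally show "?X (Suc n) \<in> borel_measurable (pre_sigma (?T (Suc n)))" .
qed

lemma adaptive_scheme_AE_bounded:
  fixes f :: "real^'m \<Rightarrow> real^'m" and g :: "real^'m \<Rightarrow> real^'d^'m"
  assumes f: "f \<in> borel_measurable borel" and g: "g \<in> borel_measurable borel"
    and h: "h \<in> borel_measurable borel" and h_pos: "\<And>x. 0 < h x"
    and \<xi>: "\<xi> \<in> borel_measurable (F 0)" and \<xi>_int: "integrable M (\<lambda>\<omega>. (norm (\<xi> \<omega>))\<^sup>2)"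
    and dissipative: "\<And>x. x \<bullet> f x + real CARD('d) / 2 * (norm (g x))\<^sup>2 + 1/2 * h x * (norm (f x))\<^sup>2
      \<le> - \<alpha> * (norm x)\<^sup>2"
  shows "AE \<omega> in M. \<exists>K. \<forall>n. exp (2 * \<alpha> * adaptive_time f g h W \<xi> n \<omega>) *
    (norm (adaptive_approx f g h W \<xi> n \<omega>))\<^sup>2 \<le> K"
proof -
  note [measurable] = f g h
  let ?T = "adaptive_time f g h W \<xi>" and ?X = "adaptive_approx f g h W \<xi>"
  note stop = adaptive_scheme_adapted(1)[OF f g h h_pos \<xi>]
  note T = measurable_stopping_time_pre_sigma[OF stop]
  note X = adaptive_scheme_adapted(2)[OF f g h h_pos \<xi>]
  have one_step: "exp (2 * \<alpha> * h x) * ((norm (x + h x *\<^sub>R f x))\<^sup>2 + real CARD('d) * h x * (norm (g x))\<^sup>2)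
    \<le> (norm x)\<^sup>2" for x
  proof -
    \<comment> \<open>Expanding the square, all terms besides |x|^2 are exactly 2 h(x) times the
      left-hand side of Assumption E2.\<close>
    have "(norm (x + h x *\<^sub>R f x))\<^sup>2 + real CARD('d) * h x * (norm (g x))\<^sup>2
      = (norm x)\<^sup>2 + 2 * h x * (x \<bullet> f x + real CARD('d) / 2 * (norm (g x))\<^sup>2 + 1/2 * h x * (norm (f x))\<^sup>2)"
      by (simp add: power2_norm_eq_inner inner_commute algebra_simps)
    also have "\<dots> \<le> (norm x)\<^sup>2 + 2 * h x * (- \<alpha> * (norm x)\<^sup>2)"
      using h_pos[of x] by (intro add_left_mono mult_left_mono dissipative) simp
    also have "\<dots> = (1 + (- 2 * \<alpha> * h x)) * (norm x)\<^sup>2"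
      by (simp add: algebra_simps)
    also have "\<dots> \<le> exp (- 2 * \<alpha> * h x) * (norm x)\<^sup>2"
      by (intro mult_right_mono exp_ge_add_one_self) simp
    finally have "exp (2 * \<alpha> * h x) * ((norm (x + h x *\<^sub>R f x))\<^sup>2 + real CARD('d) * h x * (norm (g x))\<^sup>2)
      \<le> exp (2 * \<alpha> * h x) * (exp (- 2 * \<alpha> * h x) * (norm x)\<^sup>2)"
      by (rule mult_left_mono) simp
    then show ?thesis by (simp add: mult.assoc[symmetric] exp_add[symmetric])
  qed
  show ?thesis
  proof (rule nonneg_supermartingale_AE_bounded[where G = "\<lambda>n. pre_sigma (?T n)"])
    fix n
    show "subalgebra M (pre_sigma (?T n))" by (rule subalgebra_pre_sigma[OF stop])
    show "sets (pre_sigma (?T n)) \<subseteq> sets (pre_sigma (?T (Suc n)))"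
      by (rule mono_pre_sigma[OF stop stop]) (simp add: h_pos less_imp_le)
    show "(\<lambda>\<omega>. exp (2 * \<alpha> * ?T n \<omega>) * (norm (?X n \<omega>))\<^sup>2) \<in> borel_measurable (pre_sigma (?T n))"
      using T[of n] X[of n] by measurable
    fix D assume D: "D \<in> sets (pre_sigma (?T n))"
    \<comment> \<open>The weight already carries the next time: \<open>?T (Suc n)\<close> is known
      at time \<open>?T n\<close>, since the step size is. The exponential factor can thus stay
      outside the Gaussian average.\<close>
    let ?q = "\<lambda>\<omega>. indicator D \<omega> * ennreal (exp (2 * \<alpha> * ?T (Suc n) \<omega>))"
    have "(\<integral>\<^sup>+\<omega>. indicator D \<omega> * ennreal (exp (2 * \<alpha> * ?T (Suc n) \<omega>) * (norm (?X (Suc n) \<omega>))\<^sup>2) \<partial>M)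
      = (\<integral>\<^sup>+\<omega>. ?q \<omega> * ennreal ((norm ((?X n \<omega> + h (?X n \<omega>) *\<^sub>R f (?X n \<omega>)) +
          g (?X n \<omega>) *v (W (?T n \<omega> + h (?X n \<omega>)) \<omega> - W (?T n \<omega>) \<omega>)))\<^sup>2) \<partial>M)"
      by (simp only: adaptive_approx_Suc ennreal_mult' exp_ge_zero mult.assoc)
    also have "\<dots> \<le> (\<integral>\<^sup>+\<omega>. ?q \<omega> * ennreal ((norm (?X n \<omega> + h (?X n \<omega>) *\<^sub>R f (?X n \<omega>)))\<^sup>2
        + real CARD('d) * h (?X n \<omega>) * (norm (g (?X n \<omega>)))\<^sup>2) \<partial>M)"
    proof (rule nn_integral_stopped_increment_le[OF stop])
      note [measurable] = T[of n] X[of n] D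
      show "(\<lambda>\<omega>. h (?X n \<omega>)) \<in> borel_measurable (pre_sigma (?T n))"
        "(\<lambda>\<omega>. ?X n \<omega> + h (?X n \<omega>) *\<^sub>R f (?X n \<omega>)) \<in> borel_measurable (pre_sigma (?T n))"
        "(\<lambda>\<omega>. g (?X n \<omega>)) \<in> borel_measurable (pre_sigma (?T n))"
        by measurable
      show "?q \<in> borel_measurable (pre_sigma (?T n))"
        unfolding adaptive_time_Suc by measurable
    qed (auto simp: h_pos less_imp_le adaptive_time_nonneg[OF h_pos] ennreal_mult_less_top split: split_indicator)
    also have "\<dots> \<le> (\<integral>\<^sup>+\<omega>. indicator D \<omega> * ennreal (exp (2 * \<alpha> * ?T n \<omega>) * (norm (?X n \<omega>))\<^sup>2) \<partial>M)"
    proof (rule nn_integral_mono)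
      fix \<omega>
      have "exp (2 * \<alpha> * ?T (Suc n) \<omega>) * ((norm (?X n \<omega> + h (?X n \<omega>) *\<^sub>R f (?X n \<omega>)))\<^sup>2
          + real CARD('d) * h (?X n \<omega>) * (norm (g (?X n \<omega>)))\<^sup>2)
        \<le> exp (2 * \<alpha> * ?T n \<omega>) * (norm (?X n \<omega>))\<^sup>2"
        using mult_left_mono[OF one_step[of "?X n \<omega>"], of "exp (2 * \<alpha> * ?T n \<omega>)"]
        by (simp add: distrib_left exp_add mult.assoc)
      then show "?q \<omega> * ennreal ((norm (?X n \<omega> + h (?X n \<omega>) *\<^sub>R f (?X n \<omega>)))\<^sup>2
          + real CARD('d) * h (?X n \<omega>) * (norm (g (?X n \<omega>)))\<^sup>2)
        \<le> indicator D \<omega> * ennreal (exp (2 * \<alpha> * ?T n \<omega>) * (norm (?X n \<omega>))\<^sup>2)"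
        unfolding mult.assoc ennreal_mult'[OF exp_ge_zero, symmetric]
        by (intro mult_left_mono ennreal_leI) simp_all
    qed
    finally show "(\<integral>\<^sup>+\<omega>. indicator D \<omega> * ennreal (exp (2 * \<alpha> * ?T (Suc n) \<omega>) * (norm (?X (Suc n) \<omega>))\<^sup>2) \<partial>M)
      \<le> (\<integral>\<^sup>+\<omega>. indicator D \<omega> * ennreal (exp (2 * \<alpha> * ?T n \<omega>) * (norm (?X n \<omega>))\<^sup>2) \<partial>M)" .
  next
    show "(\<integral>\<^sup>+\<omega>. ennreal (exp (2 * \<alpha> * ?T 0 \<omega>) * (norm (?X 0 \<omega>))\<^sup>2) \<partial>M) < \<infinity>"
      using \<xi>_int by (simp add: integrable_iff_bounded)
  qed
qed

end

theorem theorem6p8: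
  fixes M :: "'w measure"
    and F :: "real \<Rightarrow> 'w measure"
    and W :: "real \<Rightarrow> 'w \<Rightarrow> real^'d"
    and f :: "real^'m \<Rightarrow> real^'m"
    and g :: "real^'m \<Rightarrow> real^'d^'m"
    and \<xi> :: "'w \<Rightarrow> real^'m"
    and h :: "real \<Rightarrow> real^'m \<Rightarrow> real"
    and \<delta> :: real
  assumes "prob_space M" and "complete_measure M"
    and "usual_filtration M F"
    and "standard_brownian_motion M F W"
    and "f \<in> borel_measurable borel" and "g \<in> borel_measurable borel"
    and "\<xi> \<in> borel_measurable (F 0)"
    and "integrable M (\<lambda>\<omega>. (norm (\<xi> \<omega>))\<^sup>2)"
    and "\<And>\<delta>' x. 0 < \<delta>' \<Longrightarrow> \<delta>' < 1 \<Longrightarrow> 0 < h \<delta>' x"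
    and "0 < \<delta>" and "\<delta> < 1"
    and "assumption_E1 f g"
    and "assumption_E2 f g (h \<delta>)"
  shows "as_exponentially_stable M (adaptive_time f g (h \<delta>) W \<xi>) (adaptive_approx f g (h \<delta>) W \<xi>)"
proof -
  obtain W' where W': "continuous_brownian_motion M (\<lambda>t. F (max 0 t)) W'"
    and eq: "AE \<omega> in M. \<forall>t. W' t \<omega> = W t \<omega>"
    using brownian_motion_continuous_modification assms(1,3,4) by blast
  have h_pos: "0 < h \<delta> x" for x using assms(9-11) by blast
  have h_cont: "continuous_on UNIV (h \<delta>)"
    using assms(13) by (simp add: assumption_E2_def)
  obtain \<alpha> where \<alpha>: "0 < \<alpha>" and dissipative:
    "\<And>x. x \<bullet> f x + real CARD('d) / 2 * (norm (g x))\<^sup>2 + 1/2 * h \<delta> x * (norm (f x))\<^sup>2 \<le> - \<alpha> * (norm x)\<^sup>2"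
    using assms(13) by (auto simp: assumption_E2_def frobenius_norm_eq_norm)
  have "AE \<omega> in M. \<exists>K. \<forall>n. exp (2 * \<alpha> * adaptive_time f g (h \<delta>) W' \<xi> n \<omega>) *
      (norm (adaptive_approx f g (h \<delta>) W' \<xi> n \<omega>))\<^sup>2 \<le> K"
    using assms(7)
    by (intro continuous_brownian_motion.adaptive_scheme_AE_bounded[OF W'] assms h_pos dissipative
        borel_measurable_continuous_onI h_cont) simp
  \<comment> \<open>Off one null set the paths of \<open>W'\<close> and \<open>W\<close> agree at
    all times, so the bound transfers to the scheme driven by \<open>W\<close>.\<close>
  with eq have "AE \<omega> in M. limsup (\<lambda>n. log_ext (norm (adaptive_approx f g (h \<delta>) W \<xi> n \<omega>))
      / ereal (adaptive_time f g (h \<delta>) W \<xi> n \<omega>)) \<le> ereal (- \<alpha>)"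
  proof eventually_elim
    case (elim \<omega>)
    then have "adaptive_state f g (h \<delta>) W' \<xi> n \<omega> = adaptive_state f g (h \<delta>) W \<xi> n \<omega>" for n
      by (intro adaptive_state_cong) blast
    with elim(2) obtain K where K: "\<And>n. exp (2 * \<alpha> * adaptive_time f g (h \<delta>) W \<xi> n \<omega>) *
        (norm (adaptive_approx f g (h \<delta>) W \<xi> n \<omega>))\<^sup>2 \<le> K"
      by (auto simp: adaptive_time_def adaptive_approx_def)
    show ?case
      by (rule limsup_log_norm_le[OF h_cont h_pos _ _ K \<alpha>]) simp_all
  qed
  with \<alpha> show ?thesis
    unfolding as_exponentially_stable_def by blast
qed

end
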